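(* Let $d\ge 3$ be odd and let $V=(\mathbb{C}^2)^{\otimes d}$. Then for each integer $n\in[0,2^d-2]$ the linear map $$L:\bigwedge^nV\longrightarrow\bigwedge^{n+2}V,\qquad L(v)=\omega\wedge v,$$ where $\omega=\omega_{d,2}$, has full rank (i.e. is injective or surjective).
   Context: The Cayley form for $k=2$ is $$\omega_{d,2}=\sum_{\pi_1,\ldots,\pi_d\in S_2}\mathrm{sgn}(\pi_1\cdots\pi_d)\,\left(e_{\pi_1(1)}\otimes\cdots\otimes e_{\pi_d(1)}\right)\wedge\left(e_{\pi_1(2)}\otimes\cdots\otimes e_{\pi_d(2)}\right)\in\bigwedge^2V,$$ where $e_1,e_2$ is the standard basis of $\mathbb{C}^2$. *)

theory Defs
  imports "HOL-Analysis.Analysis" "HOL-Library.Poly_Mapping"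
begin

section \<open>The exterior algebra of a coordinate space\<close>

text \<open>
  Lists form the free monoid, so \<open>'v list \<Rightarrow>\<^sub>0 complex\<close>, with the convolution product of
  \<open>Poly_Mapping\<close>, is the free associative unital complex algebra on the set \<open>'v\<close>.
\<close>

instantiation list :: (type) monoid_add
begin

definition zero_list :: "'a list" where "zero_list = []"
definition plus_list :: "'a list \<Rightarrow> 'a list \<Rightarrow> 'a list" where "plus_list = (@)"

instance by standard (simp_all add: zero_list_def plus_list_def)

end

text \<open>
  Let \<open>V = \<complex>\<^sup>b\<close>.  The exterior algebra of \<open>V\<close> is the free algebra on the underlying set of \<open>V\<close>
  modulo the two-sided ideal that forces the generators to depend linearly on the vector (which
  gives the tensor algebra of \<open>V\<close>) and the square of every vector to vanish.
\<close>

abbreviation free_gen :: "complex^'b \<Rightarrow> (complex^'b) list \<Rightarrow>\<^sub>0 complex"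
  where "free_gen v \<equiv> Poly_Mapping.single [v] 1"

abbreviation free_const :: "complex \<Rightarrow> (complex^'b) list \<Rightarrow>\<^sub>0 complex"
  where "free_const c \<equiv> Poly_Mapping.single 0 c"

definition ext_relators :: "((complex^'b) list \<Rightarrow>\<^sub>0 complex) set"
  where "ext_relators =
     {free_gen (u + v) - free_gen u - free_gen v | u v. True}
   \<union> {free_gen (c *s v) - free_const c * free_gen v | c v. True}
   \<union> {free_gen v * free_gen v | v. True}"

inductive_set ext_ideal :: "((complex^'b) list \<Rightarrow>\<^sub>0 complex) set"
  where
    zero: "0 \<in> ext_ideal"
  | add: "p \<in> ext_ideal \<Longrightarrow> q \<in> ext_ideal \<Longrightarrow> p + q \<in> ext_ideal"
  | gen: "r \<in> ext_relators \<Longrightarrow> a * r * b \<in> ext_ideal"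

lemma ext_ideal_mult_left: "p \<in> ext_ideal \<Longrightarrow> a * p \<in> ext_ideal"
proof (induction rule: ext_ideal.induct)
  case (gen r b c)
  then show ?case using ext_ideal.gen[of r "a * b" c] by (simp add: mult.assoc)
qed (auto simp: distrib_left intro: ext_ideal.intros)

lemma ext_ideal_mult_right: "p \<in> ext_ideal \<Longrightarrow> p * a \<in> ext_ideal"
proof (induction rule: ext_ideal.induct)
  case (gen r b c)
  then show ?case using ext_ideal.gen[of r b "c * a"] by (simp add: mult.assoc)
qed (auto simp: distrib_right intro: ext_ideal.intros)

lemma ext_ideal_uminus: "p \<in> ext_ideal \<Longrightarrow> - p \<in> ext_ideal"
  using ext_ideal_mult_left[of p "-1"] by simp

lemma ext_ideal_diff: "p \<in> ext_ideal \<Longrightarrow> q \<in> ext_ideal \<Longrightarrow> p - q \<in> ext_ideal"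
  using ext_ideal.add[of p "- q"] ext_ideal_uminus[of q] by simp

lemma ext_ideal_relator: "r \<in> ext_relators \<Longrightarrow> r \<in> ext_ideal"
  using ext_ideal.gen[of r 1 1] by simp

lemma one_notin_ext_ideal: "(1 :: (complex^'b) list \<Rightarrow>\<^sub>0 complex) \<notin> ext_ideal"
proof -
  have app0: "u + w = 0 \<longleftrightarrow> u = 0 \<and> w = 0" for u w :: "'a list"
    by (simp add: plus_list_def zero_list_def)
  have *: "Poly_Mapping.lookup (p * q) 0 = Poly_Mapping.lookup p 0 * Poly_Mapping.lookup q 0"
    for p q :: "'a list \<Rightarrow>\<^sub>0 complex"
  proof -
    have inner: "Sum_any (\<lambda>k. Poly_Mapping.lookup q k when 0 = l + k) =
        (Poly_Mapping.lookup q 0 when l = 0)" for l :: "'a list"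
    proof (cases "l = 0")
      case True
      then show ?thesis by (simp add: Sum_any_when_equal')
    next
      case False
      then have "0 \<noteq> l + k" for k using app0[of l k] by metis
      with False show ?thesis by simp
    qed
    have "Poly_Mapping.lookup (p * q) 0 =
        Sum_any (\<lambda>l. Poly_Mapping.lookup p l * Poly_Mapping.lookup q 0 when l = 0)"
      unfolding lookup_mult inner by (simp only: mult_when)
    then show ?thesis by (simp only: Sum_any_when_equal)
  qed
  have gen: "Poly_Mapping.lookup r 0 = 0" if "r \<in> ext_relators" for r :: "(complex^'b) list \<Rightarrow>\<^sub>0 complex"
  proof -
    have "[v] \<noteq> 0" for v :: "complex^'b" by (simp add: zero_list_def)
    with that show ?thesis
      by (auto simp: ext_relators_def * lookup_minus lookup_single)
  qed
  have "Poly_Mapping.lookup p 0 = 0" if "p \<in> ext_ideal" for p :: "(complex^'b) list \<Rightarrow>\<^sub>0 complex"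
    using that by (induction rule: ext_ideal.induct) (auto simp: * gen lookup_add)
  then show ?thesis by (metis lookup_one_zero zero_neq_one)
qed

definition ext_rel :: "((complex^'b) list \<Rightarrow>\<^sub>0 complex) \<Rightarrow> ((complex^'b) list \<Rightarrow>\<^sub>0 complex) \<Rightarrow> bool"
  where "ext_rel p q \<longleftrightarrow> p - q \<in> ext_ideal"

lemma equivp_ext_rel: "equivp ext_rel"
proof (rule equivpI)
  show "reflp ext_rel"
    by (auto simp: reflp_def ext_rel_def ext_ideal.zero)
  show "symp ext_rel"
    using ext_ideal_uminus by (fastforce simp: symp_def ext_rel_def)
  show "transp ext_rel"
    unfolding transp_def ext_rel_def using ext_ideal.add by fastforce
qed

quotient_type (overloaded) 'b exterior = "(complex^'b::finite) list \<Rightarrow>\<^sub>0 complex" / ext_rel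
  by (rule equivp_ext_rel)

text \<open>The product \<open>x * y\<close> of the following ring structure is the wedge product.\<close>

instantiation exterior :: (finite) ring_1
begin

lift_definition zero_exterior :: "'a exterior" is 0 .
lift_definition one_exterior :: "'a exterior" is 1 .

lift_definition plus_exterior :: "'a exterior \<Rightarrow> 'a exterior \<Rightarrow> 'a exterior" is "(+)"
proof -
  fix p p' q q' :: "(complex^'a) list \<Rightarrow>\<^sub>0 complex"
  assume "ext_rel p p'" and "ext_rel q q'"
  then have "(p - p') + (q - q') \<in> ext_ideal"
    by (simp add: ext_rel_def ext_ideal.add)
  then show "ext_rel (p + q) (p' + q')"
    by (simp add: ext_rel_def algebra_simps)
qed

lift_definition uminus_exterior :: "'a exterior \<Rightarrow> 'a exterior" is uminus
proof -
  fix p p' :: "(complex^'a) list \<Rightarrow>\<^sub>0 complex"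
  assume "ext_rel p p'"
  then have "- (p - p') \<in> ext_ideal"
    unfolding ext_rel_def by (rule ext_ideal_uminus)
  then show "ext_rel (- p) (- p')"
    by (simp add: ext_rel_def)
qed

lift_definition minus_exterior :: "'a exterior \<Rightarrow> 'a exterior \<Rightarrow> 'a exterior" is "(-)"
proof -
  fix p p' q q' :: "(complex^'a) list \<Rightarrow>\<^sub>0 complex"
  assume "ext_rel p p'" and "ext_rel q q'"
  then have "(p - p') - (q - q') \<in> ext_ideal"
    by (simp add: ext_rel_def ext_ideal_diff)
  then show "ext_rel (p - q) (p' - q')"
    by (simp add: ext_rel_def algebra_simps)
qed

lift_definition times_exterior :: "'a exterior \<Rightarrow> 'a exterior \<Rightarrow> 'a exterior" is "(*)"
proof -
  fix p p' q q' :: "(complex^'a) list \<Rightarrow>\<^sub>0 complex"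
  assume "ext_rel p p'" and "ext_rel q q'"
  then have "(p - p') * q + p' * (q - q') \<in> ext_ideal"
    by (simp add: ext_rel_def ext_ideal.add ext_ideal_mult_left ext_ideal_mult_right)
  then show "ext_rel (p * q) (p' * q')"
    by (simp add: ext_rel_def algebra_simps)
qed

instance
proof
  show "(0::'a exterior) \<noteq> 1"
  proof (transfer, unfold ext_rel_def)
    show "\<not> (0::(complex^'a) list \<Rightarrow>\<^sub>0 complex) - 1 \<in> ext_ideal"
      using ext_ideal_uminus[of "- 1"] one_notin_ext_ideal by auto
  qed
qed (transfer; simp add: ext_rel_def algebra_simps ext_ideal.zero)+

end

lift_definition ext_vec :: "complex^'b \<Rightarrow> 'b::finite exterior" is free_gen .

lift_definition ext_const :: "complex \<Rightarrow> 'b::finite exterior" is free_const .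

definition ext_scale :: "complex \<Rightarrow> 'b::finite exterior \<Rightarrow> 'b exterior"
  where "ext_scale c x = ext_const c * x"

lemma ext_const_add: "ext_const (a + b) = ext_const a + ext_const b"
  by transfer (simp add: single_add ext_rel_def ext_ideal.zero)

lemma ext_const_mult: "ext_const (a * b) = ext_const a * ext_const b"
  by transfer (simp add: mult_single ext_rel_def ext_ideal.zero)

lemma ext_const_1: "ext_const 1 = 1"
  by transfer (simp add: ext_rel_def ext_ideal.zero)

lemma ext_const_commute: "ext_const c * x = x * ext_const c"
proof transfer
  fix c and p :: "(complex^'b) list \<Rightarrow>\<^sub>0 complex"
  have "free_const c * p = p * free_const c"
  proof (induction p rule: update_induct)
    case (update f a b)
    then have "Poly_Mapping.update a b f = f + Poly_Mapping.single a b"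
      by (intro poly_mapping_eqI)
        (auto simp: lookup_add lookup_update lookup_single in_keys_iff when_def)
    with update.IH show ?case
      by (simp add: distrib_left distrib_right mult_single mult.commute)
  qed simp
  then show "ext_rel (free_const c * p) (p * free_const c)"
    by (simp add: ext_rel_def ext_ideal.zero)
qed

lemma ext_scale_mult_left: "ext_scale c x * y = ext_scale c (x * y)"
  by (simp add: ext_scale_def mult.assoc)

lemma ext_scale_mult_right: "x * ext_scale c y = ext_scale c (x * y)"
proof -
  have "x * (ext_const c * y) = ext_const c * x * y"
    by (simp only: ext_const_commute[of c x] mult.assoc)
  then show ?thesis by (simp add: ext_scale_def mult.assoc)
qed

global_interpretation ext: vector_space ext_scale
  by standard
    (simp_all add: ext_scale_def ext_const_add ext_const_mult ext_const_1 algebra_simps)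

lemma ext_vec_add: "ext_vec (u + v) = ext_vec u + ext_vec v"
proof transfer
  fix u v :: "complex^'b"
  have "free_gen (u + v) - free_gen u - free_gen v \<in> ext_ideal"
    by (rule ext_ideal_relator) (auto simp: ext_relators_def)
  then show "ext_rel (free_gen (u + v)) (free_gen u + free_gen v)"
    by (simp add: ext_rel_def algebra_simps)
qed

lemma ext_vec_scale: "ext_vec (c *s v) = ext_scale c (ext_vec v)"
  unfolding ext_scale_def
proof transfer
  fix c and v :: "complex^'b"
  show "ext_rel (free_gen (c *s v)) (free_const c * free_gen v)"
    unfolding ext_rel_def by (rule ext_ideal_relator) (auto simp: ext_relators_def)
qed

lemma ext_vec_square: "ext_vec v * ext_vec v = 0"
proof transfer
  fix v :: "complex^'b"
  have "free_gen v * free_gen v \<in> ext_ideal"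
    by (rule ext_ideal_relator) (auto simp: ext_relators_def)
  then show "ext_rel (free_gen v * free_gen v) 0"
    by (simp add: ext_rel_def)
qed

definition ext_power :: "nat \<Rightarrow> 'b::finite exterior set"
  where "ext_power n = ext.span {prod_list (map ext_vec vs) | vs. length vs = n}"

section \<open>The Cayley form\<close>

text \<open>
  The tensor power \<open>(\<complex>\<^sup>2)\<^sup>\<otimes>\<^sup>d\<close> is the space of \<open>2 \<times> \<dots> \<times> 2\<close> arrays.  The \<open>d\<close> tensor factors are
  indexed by the type \<open>'d\<close>, and an array is indexed by the functions from \<open>'d\<close> to the
  two-element type \<open>2\<close>, whose elements are \<open>1\<close> and \<open>2\<close> (where \<open>2 = 0\<close>).
\<close>

definition pure_tensor :: "('d::finite \<Rightarrow> complex^2) \<Rightarrow> complex^('d \<Rightarrow> 2)"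
  where "pure_tensor v = (\<chi> i. \<Prod>j\<in>UNIV. v j $ i j)"

abbreviation std_basis :: "2 \<Rightarrow> complex^2"
  where "std_basis i \<equiv> axis i 1"

text \<open>
  The sign of the product of the permutations \<open>\<pi> j\<close> is written as the product of their signs,
  since the index type \<open>'d\<close> carries no order.
\<close>

definition cayley_form :: "('d::finite \<Rightarrow> 2) exterior"
  where "cayley_form =
    (\<Sum>\<pi> | \<forall>j. \<pi> j permutes UNIV.
       of_int (\<Prod>j\<in>UNIV. sign (\<pi> j)) *
       (ext_vec (pure_tensor (\<lambda>j. std_basis (\<pi> j 1))) *
        ext_vec (pure_tensor (\<lambda>j. std_basis (\<pi> j 2)))))"

lemma prod_vecs_in_ext_power: "prod_list (map ext_vec vs) \<in> ext_power (length vs)"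
  unfolding ext_power_def by (rule ext.span_base) blast

lemma ext_power_mult:
  assumes "x \<in> ext_power m" and "y \<in> ext_power n"
  shows "x * y \<in> ext_power (m + n)"
proof -
  have gen: "prod_list (map ext_vec us) * y \<in> ext_power (m + n)" if "length us = m" for us
    using assms(2) unfolding ext_power_def
  proof (induction rule: ext.span_induct_alt)
    case base
    then show ?case by (simp add: ext.span_zero)
  next
    case (step c z y)
    then obtain ws where ws: "z = prod_list (map ext_vec ws)" "length ws = n" by auto
    have "prod_list (map ext_vec us) * z = prod_list (map ext_vec (us @ ws))"
      by (simp add: ws)
    then have "prod_list (map ext_vec us) * z \<in>
        ext.span {prod_list (map ext_vec vs) | vs. length vs = m + n}"
      using prod_vecs_in_ext_power[of "us @ ws"] that ws(2) by (simp add: ext_power_def)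
    moreover have "prod_list (map ext_vec us) * (ext_scale c z + y) =
        ext_scale c (prod_list (map ext_vec us) * z) + prod_list (map ext_vec us) * y"
      by (simp only: distrib_left ext_scale_mult_right)
    ultimately show ?case
      using step.IH by (simp only: ext.span_add ext.span_scale)
  qed
  show ?thesis
    using assms(1) unfolding ext_power_def[of m]
  proof (induction rule: ext.span_induct_alt)
    case base
    then show ?case by (simp add: ext_power_def ext.span_zero)
  next
    case (step c z x)
    then obtain us where "z = prod_list (map ext_vec us)" "length us = m" by blast
    with gen have "z * y \<in> ext_power (m + n)" by blast
    with step.IH show ?case
      by (simp only: distrib_right ext_scale_mult_left ext_power_def ext.span_add ext.span_scale)
  qed
qed

lemma cayley_form_in_ext_power_2: "cayley_form \<in> ext_power 2"
proof -
  have c: "of_int k = (ext_const (of_int k) :: 'b::finite exterior)" for k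
  proof (induction k rule: int_induct[where k = 0])
    case base
    have "ext_const 0 = (ext_const 0 + ext_const 0 :: 'b exterior)"
      by (simp flip: ext_const_add)
    then show ?case by simp
  next
    case (step1 i)
    then show ?case by (simp add: ext_const_add ext_const_1)
  next
    case (step2 i)
    have "ext_const (of_int i) = (ext_const (of_int (i - 1)) + 1 :: 'b exterior)"
      by (simp flip: ext_const_1 ext_const_add)
    with step2 show ?case by simp
  qed
  have *: "ext_vec u * ext_vec v \<in> ext_power 2" for u v :: "complex^'b::finite"
    using prod_vecs_in_ext_power[of "[u, v]"] by (simp add: numeral_2_eq_2)
  show ?thesis
    unfolding cayley_form_def c ext_scale_def[symmetric] ext_power_def
    by (intro ext.span_sum ext.span_scale *[unfolded ext_power_def])
qed

lemma linear_ext_mult: "Vector_Spaces.linear ext_scale ext_scale (\<lambda>v. w * v)"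
  by unfold_locales (simp_all add: distrib_left ext_scale_mult_right)

end

theory Submission
  imports Defs
begin

text \<open>
  As \<open>d\<close> is odd, \<open>\<omega> = \<Sum>\<^sub>i s\<^sub>i e\<^sub>i \<and> e\<^sub>i\<^sub>'\<close>, where \<open>i'\<close> is the complementary index and the signs
  satisfy \<open>s\<^sub>i\<^sub>' = - s\<^sub>i\<close>; so \<open>\<omega>\<close> is a symplectic form.  Let \<open>M = \<Sum>\<^sub>i s\<^sub>i \<iota>\<^sub>i\<^sub>' \<iota>\<^sub>i\<close>
  be the dual lowering operator, with \<open>\<iota>\<^sub>i\<close> the contraction by the \<open>i\<close>-th coordinate.  On degree \<open>p\<close>
  the commutator of \<open>M\<close> and \<open>L\<close> is the scalar \<open>4 (2\<^sup>d\<^sup>-\<^sup>1 - p)\<close>, an \<open>sl\<^sub>2\<close>-relation.  Since \<open>M\<close> and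
  \<open>L\<close> are nilpotent, it makes \<open>L\<close> injective on degrees \<open>n < 2\<^sup>d\<^sup>-\<^sup>1\<close> and surjective onto degrees
  \<open>n + 2 > 2\<^sup>d\<^sup>-\<^sup>1\<close>.
\<close>

section \<open>Representations of the exterior algebra\<close>

lemma poly_mapping_induct_single [case_names zero add single]:
  assumes "P 0"
    and "\<And>p q. P p \<Longrightarrow> P q \<Longrightarrow> P (p + q)"
    and "\<And>k c. P (Poly_Mapping.single k c)"
  shows "P (p :: 'a \<Rightarrow>\<^sub>0 'b::comm_monoid_add)"
proof (induction p rule: update_induct)
  case const
  show ?case by (rule assms(1))
next
  case (update f a b)
  then have "Poly_Mapping.update a b f = f + Poly_Mapping.single a b"
    by (intro poly_mapping_eqI)
      (auto simp: lookup_add lookup_update lookup_single in_keys_iff when_def)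
  with update.IH assms show ?case by simp
qed

lemma exterior_cases_abs: obtains p where "x = abs_exterior p"
  by (metis Quotient3_abs_rep Quotient3_exterior)

text \<open>The universal property of the exterior algebra in operator form: operators
  \<open>T v\<close> that depend linearly on \<open>v\<close> and square to zero extend to an action
  \<open>act\<close> of the whole algebra.\<close>

locale ext_action = vector_space scale
  for scale :: "complex \<Rightarrow> 'm::ab_group_add \<Rightarrow> 'm" +
  fixes T :: "complex^'b::finite \<Rightarrow> 'm \<Rightarrow> 'm"
  assumes T_add_left: "T (u + v) x = T u x + T v x"
    and T_scale_left: "T (c *s v) x = scale c (T v x)"
    and T_add_right: "T v (x + y) = T v x + T v y"
    and T_scale_right: "T v (scale c x) = scale c (T v x)"
    and T_square: "T v (T v x) = 0"
begin

definition free_act :: "((complex^'b) list \<Rightarrow>\<^sub>0 complex) \<Rightarrow> 'm \<Rightarrow> 'm"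
  where "free_act p x = (\<Sum>w\<in>Poly_Mapping.keys p. scale (Poly_Mapping.lookup p w) (foldr T w x))"

lemma free_act_superset:
  assumes "finite S" and "Poly_Mapping.keys p \<subseteq> S"
  shows "free_act p x = (\<Sum>w\<in>S. scale (Poly_Mapping.lookup p w) (foldr T w x))"
  unfolding free_act_def using assms
  by (intro sum.mono_neutral_left) (auto simp: in_keys_iff)

lemma free_act_zero [simp]: "free_act 0 x = 0"
  by (simp add: free_act_def)

lemma free_act_single: "free_act (Poly_Mapping.single w c) x = scale c (foldr T w x)"
  by (simp add: free_act_superset[of "{w}"] lookup_single)

lemma free_act_add: "free_act (p + q) x = free_act p x + free_act q x"
proof -
  let ?S = "Poly_Mapping.keys p \<union> Poly_Mapping.keys q"
  have "Poly_Mapping.keys (p + q) \<subseteq> ?S" by (rule keys_add)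
  then show ?thesis
    by (simp add: free_act_superset[of ?S] lookup_add scale_left_distrib sum.distrib)
qed

lemma free_act_diff: "free_act (p - q) x = free_act p x - free_act q x"
  using free_act_add[of "p - q" q x] by simp

lemma T_zero_right [simp]: "T v 0 = 0"
  using T_add_right[of v 0 0] by simp

lemma foldr_T_add: "foldr T w (x + y) = foldr T w x + foldr T w y"
  by (induction w) (simp_all add: T_add_right)

lemma foldr_T_scale: "foldr T w (scale c x) = scale c (foldr T w x)"
  by (induction w) (simp_all add: T_scale_right)

lemma free_act_add_right: "free_act p (x + y) = free_act p x + free_act p y"
  by (simp add: free_act_def foldr_T_add scale_right_distrib sum.distrib)

lemma free_act_zero_right [simp]: "free_act p 0 = 0"
  using free_act_add_right[of p 0 0] by simp

text \<open>Both sides are additive in \<open>p\<close> and in \<open>q\<close>, which leaves single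
  words, where concatenation becomes composition of operators.\<close>

lemma free_act_mult: "free_act (p * q) x = free_act p (free_act q x)"
proof (induction p rule: poly_mapping_induct_single)
  case (single v a)
  show ?case
  proof (induction q rule: poly_mapping_induct_single)
    case (single w b)
    show ?case
      by (simp add: mult_single free_act_single plus_list_def foldr_T_scale)
  qed (simp_all add: distrib_left free_act_add free_act_add_right)
qed (simp_all add: distrib_right free_act_add)

lemma free_act_relator: "r \<in> ext_relators \<Longrightarrow> free_act r x = 0"
  unfolding ext_relators_def
  by (auto simp: free_act_diff free_act_mult free_act_single T_add_left T_scale_left T_square
      zero_list_def)

lemma free_act_ideal: "p \<in> ext_ideal \<Longrightarrow> free_act p x = 0"
  by (induction rule: ext_ideal.induct)
    (simp_all add: free_act_add free_act_mult free_act_relator)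

definition act :: "'b exterior \<Rightarrow> 'm \<Rightarrow> 'm"
  where "act x = free_act (rep_exterior x)"

text \<open>Two representatives differ by an element of the ideal, which acts as zero, so any
  representative may be used to compute the action.\<close>

lemma act_abs: "act (abs_exterior p) m = free_act p m"
proof -
  have "ext_rel (rep_exterior (abs_exterior p)) p"
    by (metis Quotient3_abs_rep Quotient3_exterior exterior.abs_eq_iff)
  then show ?thesis
    using free_act_ideal[of "rep_exterior (abs_exterior p) - p" m]
    by (simp add: ext_rel_def act_def free_act_diff)
qed

lemma act_add: "act (x + y) m = act x m + act y m"
  by (rule exterior_cases_abs[of x], rule exterior_cases_abs[of y])
    (simp add: plus_exterior.abs_eq act_abs free_act_add)

lemma act_mult: "act (x * y) m = act x (act y m)"
  by (rule exterior_cases_abs[of x], rule exterior_cases_abs[of y])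
    (simp add: times_exterior.abs_eq act_abs free_act_mult)

lemma act_vec: "act (ext_vec v) m = T v m"
  by (simp add: ext_vec.abs_eq act_abs free_act_single)

lemma act_const: "act (ext_const c) m = scale c m"
  by (simp add: ext_const.abs_eq act_abs free_act_single zero_list_def)

lemma act_one: "act 1 m = m"
  using act_const[of 1 m] by (simp add: ext_const_1)

lemma act_scale: "act (ext_scale c x) m = scale c (act x m)"
  by (simp add: ext_scale_def act_mult act_const)

end

text \<open>Classes of words span the algebra, and a word arises from the unit by prefixing one
  vector at a time. The zero element comes from scaling the unit by 0.\<close>

lemma exterior_induct [case_names one add scale vec]:
  assumes one: "P 1"
    and add: "\<And>x y. P x \<Longrightarrow> P y \<Longrightarrow> P (x + y)"
    and scale: "\<And>c x. P x \<Longrightarrow> P (ext_scale c x)"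
    and vec: "\<And>v x. P x \<Longrightarrow> P (ext_vec v * x)"
  shows "P (x :: 'b::finite exterior)"
proof -
  have P0: "P 0" using scale[OF one, of 0] by simp
  have "P (abs_exterior p)" for p :: "(complex^'b) list \<Rightarrow>\<^sub>0 complex"
  proof (induction p rule: poly_mapping_induct_single)
    case zero
    then show ?case using P0 by (simp add: zero_exterior_def)
  next
    case (add p q)
    then show ?case using assms(2) by (simp flip: plus_exterior.abs_eq)
  next
    case (single w c)
    have "P (abs_exterior (Poly_Mapping.single w 1))"
    proof (induction w)
      case Nil
      then show ?case using one by (simp add: one_exterior_def flip: zero_list_def)
    next
      case (Cons v w)
      have "Poly_Mapping.single (v # w) 1 = free_gen v * Poly_Mapping.single w (1::complex)"
        by (simp add: mult_single plus_list_def)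
      with vec[OF Cons, of v] show ?case
        by (simp add: ext_vec.abs_eq times_exterior.abs_eq)
    qed
    from scale[OF this, of c] show ?case
      by (simp add: ext_scale_def ext_const.abs_eq times_exterior.abs_eq mult_single)
  qed
  then show ?thesis by (metis exterior_cases_abs)
qed

section \<open>Contraction by a coordinate\<close>

definition contr_pair :: "'b \<Rightarrow> complex^'b \<Rightarrow> 'b exterior \<times> 'b exterior \<Rightarrow> 'b::finite exterior \<times> 'b exterior"
  where "contr_pair j v = (\<lambda>(x, y). (ext_vec v * x, ext_scale (v $ j) x - ext_vec v * y))"

text \<open>
  Left multiplication by \<open>v\<close> and contraction \<open>y = \<iota>x\<close> transform the pair \<open>(x, y)\<close> as prescribed by
  the graded Leibniz rule, and \<open>contr_pair j v\<close> has square zero.  So the universal property of the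
  exterior algebra provides the contraction.
\<close>

global_interpretation contr: ext_action
  "\<lambda>c (x :: 'b exterior \<times> 'b exterior). (ext_scale c (fst x), ext_scale c (snd x))"
  "contr_pair j :: complex^'b \<Rightarrow> _"
  for j :: "'b::finite"
  defines contr_act = contr.act
  by unfold_locales
    (auto simp: contr_pair_def ext_vec_add ext_vec_scale ext.scale_left_distrib
      ext.scale_right_distrib ext.scale_right_diff_distrib ext_scale_mult_left ext_scale_mult_right
      distrib_left distrib_right right_diff_distrib mult.assoc[symmetric] ext_vec_square
      mult.commute[of _ "_ :: complex"] zero_prod_def)

definition contr :: "'b \<Rightarrow> 'b exterior \<Rightarrow> 'b::finite exterior"
  where "contr j x = snd (contr_act j x (1, 0))"

text \<open>The start pair \<open>(1, 0)\<close> encodes that contraction kills the unit. The first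
  component reproduces \<open>x\<close>, so reading off the second component after one more factor
  yields the graded Leibniz rule \<open>contr_vec_mult\<close>.\<close>

lemma contr_act_eq: "contr_act j x (1, 0) = (x, contr j x)"
proof -
  have "fst (contr_act j x (1, 0)) = x"
  proof (induction x rule: exterior_induct)
    case (vec v x)
    then show ?case
      by (simp add: contr.act_mult contr.act_vec contr_pair_def case_prod_beta)
  qed (simp_all add: contr.act_one contr.act_add contr.act_scale)
  then show ?thesis by (simp add: contr_def prod_eq_iff)
qed

lemma contr_one [simp]: "contr j 1 = 0"
  by (simp add: contr_def contr.act_one)

lemma contr_add: "contr j (x + y) = contr j x + contr j y"
  by (simp add: contr_def contr.act_add)

lemma contr_scale: "contr j (ext_scale c x) = ext_scale c (contr j x)"
  by (simp add: contr_def contr.act_scale)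

lemma contr_vec_mult: "contr j (ext_vec v * x) = ext_scale (v $ j) x - ext_vec v * contr j x"
proof -
  have "contr_act j (ext_vec v * x) (1, 0) = contr_pair j v (contr_act j x (1, 0))"
    by (simp only: contr.act_mult contr.act_vec)
  then show ?thesis unfolding contr_act_eq by (simp add: contr_pair_def)
qed


lemma contr_zero [simp]: "contr j 0 = 0"
  using contr_add[of j 0 0] by simp

lemma contr_sum: "contr j (sum f A) = (\<Sum>a\<in>A. contr j (f a))"
  by (induction A rule: infinite_finite_induct) (simp_all add: contr_add)

section \<open>Contraction and the grading\<close>

lemma subspace_ext_power: "ext.subspace (ext_power n)"
  unfolding ext_power_def by simp

lemmas ext_power_add = ext.subspace_add[OF subspace_ext_power]
  and ext_power_scale = ext.subspace_scale[OF subspace_ext_power]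
  and ext_power_zero = ext.subspace_0[OF subspace_ext_power]
  and ext_power_diff = ext.subspace_diff[OF subspace_ext_power]
  and ext_power_sum = ext.subspace_sum[OF subspace_ext_power]

lemma ext_power_induct [consumes 1, case_names base step]:
  assumes "x \<in> ext_power n"
    and "P 0"
    and "\<And>c vs x. length vs = n \<Longrightarrow> P x \<Longrightarrow> P (ext_scale c (prod_list (map ext_vec vs)) + x)"
  shows "P x"
  using assms(1) unfolding ext_power_def
  by (induction rule: ext.span_induct_alt) (use assms(2,3) in auto)

lemma ext_vec_mult_power:
  assumes "x \<in> ext_power n"
  shows "ext_vec v * x \<in> ext_power (Suc n)"
  using ext_power_mult[OF prod_vecs_in_ext_power[of "[v]"] assms] by simp

lemma contr_power_0: "x \<in> ext_power 0 \<Longrightarrow> contr j x = 0"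
  by (induction rule: ext_power_induct) (simp_all add: contr_add contr_scale)

text \<open>The Leibniz rule either removes the first vector or keeps it and contracts the shorter
  product, so each term loses exactly one factor.\<close>

lemma contr_prod_vecs:
  "length vs = Suc n \<Longrightarrow> contr j (prod_list (map ext_vec vs)) \<in> ext_power n"
proof (induction n arbitrary: vs)
  case 0
  then obtain v where "vs = [v]" by (auto simp: length_Suc_conv)
  moreover have "ext_scale (v $ j) 1 \<in> ext_power 0"
    using prod_vecs_in_ext_power[of "[]"] by (auto intro: ext_power_scale)
  ultimately show ?case
    using contr_vec_mult[of j v 1] by simp
next
  case (Suc n)
  then obtain v ws where vs: "vs = v # ws" "length ws = Suc n" by (auto simp: length_Suc_conv)
  then have "prod_list (map ext_vec ws) \<in> ext_power (Suc n)"
    using prod_vecs_in_ext_power[of ws] by simp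
  with vs Suc.IH[of ws] show ?case
    by (auto simp: contr_vec_mult intro: ext_power_diff ext_power_scale ext_vec_mult_power)
qed

lemma contr_power_Suc: "x \<in> ext_power (Suc n) \<Longrightarrow> contr j x \<in> ext_power n"
  by (induction rule: ext_power_induct)
    (auto simp: contr_add contr_scale ext_power_zero intro: ext_power_add ext_power_scale contr_prod_vecs)

section \<open>Anticommutation and the number operator\<close>

lemma vec_eq_sum_axis: "(v :: complex^'b::finite) = (\<Sum>j\<in>UNIV. (v $ j) *s axis j 1)"
  by (simp add: vec_eq_iff axis_def if_distrib cong: if_cong)

lemma ext_vec_zero [simp]: "ext_vec 0 = 0"
  using ext_vec_add[of 0 0] by simp

lemma ext_vec_sum: "ext_vec (sum f A) = (\<Sum>a\<in>A. ext_vec (f a))"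
  by (induction A rule: infinite_finite_induct) (simp_all add: ext_vec_add)

text \<open>Polarization: expand the vanishing square of \<open>u + v\<close>.\<close>

lemma ext_vec_anticommute: "ext_vec u * ext_vec v = - (ext_vec v * ext_vec u)"
proof -
  have "ext_vec (u + v) * ext_vec (u + v) = ext_vec u * ext_vec v + ext_vec v * ext_vec u"
    by (simp only: ext_vec_add distrib_left distrib_right ext_vec_square add_0_left add_0_right add.commute)
  then show ?thesis by (simp only: ext_vec_square eq_neg_iff_add_eq_0)
qed

lemma ext_vec_left_anticommute: "ext_vec u * (ext_vec v * x) = - (ext_vec v * (ext_vec u * x))"
  by (simp only: mult.assoc[symmetric] ext_vec_anticommute[of u v] mult_minus_left)

text \<open>This is the number operator, a derivation that fixes every vector; on a product of
  \<open>n\<close> vectors it therefore counts the factors.\<close>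

lemma sum_vec_contr:
  assumes "x \<in> ext_power n"
  shows "(\<Sum>j\<in>UNIV. ext_vec (axis j 1) * contr j x) = ext_scale (of_nat n) (x :: 'b::finite exterior)"
proof -
  let ?N = "\<lambda>x :: 'b exterior. \<Sum>j\<in>UNIV. ext_vec (axis j 1) * contr j x"
  have N_vec: "?N (ext_vec v * x) = ext_vec v * x + ext_vec v * ?N x" for v x
  proof -
    \<comment> \<open>The scalar terms reassemble \<open>v\<close> from its coordinates. In the
      others, moving a basis vector past \<open>v\<close> cancels the minus sign of the Leibniz
      rule.\<close>
    have "?N (ext_vec v * x) =
        (\<Sum>j\<in>UNIV. ext_vec ((v $ j) *s axis j 1) * x + ext_vec v * (ext_vec (axis j 1) * contr j x))"
      by (simp add: contr_vec_mult right_diff_distrib ext_scale_mult_right ext_scale_mult_left ext_vec_scale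
          ext_vec_left_anticommute[where v = v and u = "axis _ 1"])
    also have "\<dots> = ext_vec v * x + ext_vec v * ?N x"
      unfolding sum.distrib sum_distrib_right[symmetric] sum_distrib_left[symmetric] ext_vec_sum[symmetric]
      by (simp flip: vec_eq_sum_axis)
    finally show ?thesis .
  qed
  have N_prod: "?N (prod_list (map ext_vec vs)) = ext_scale (of_nat (length vs)) (prod_list (map ext_vec vs))" for vs
    by (induction vs) (simp_all add: N_vec ext_scale_mult_right ext.scale_left_distrib)
  show ?thesis using assms
    by (induction rule: ext_power_induct)
      (simp_all add: contr_add contr_scale distrib_left sum.distrib ext_scale_mult_right N_prod
         ext.scale_right_distrib mult.commute flip: ext.scale_sum_right)
qed

section \<open>The raising and lowering argument\<close>

text \<open>Here \<open>m\<close> is the middle degree and \<open>c\<close> normalizes the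
  commutator. As degrees are natural numbers, \<open>M_low\<close> stands for the vanishing of
  negative degrees.\<close>

locale graded_lefschetz = vector_space scale
  for scale :: "'a::field_char_0 \<Rightarrow> 'b::ab_group_add \<Rightarrow> 'b" +
  fixes E :: "nat \<Rightarrow> 'b set" and L M :: "'b \<Rightarrow> 'b" and c m :: int
  assumes L_add: "L (x + y) = L x + L y" and L_scale: "L (scale a x) = scale a (L x)"
    and M_add: "M (x + y) = M x + M y" and M_scale: "M (scale a x) = scale a (M x)"
    and subspace_E: "subspace (E p)"
    and L_E: "x \<in> E p \<Longrightarrow> L x \<in> E (p + 2)"
    and M_E: "x \<in> E (p + 2) \<Longrightarrow> M x \<in> E p"
    and M_low: "x \<in> E p \<Longrightarrow> p < 2 \<Longrightarrow> M x = 0"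
    and comm: "x \<in> E p \<Longrightarrow> M (L x) = L (M x) + scale (of_int (c * (m - int p))) x"
    and c_pos: "c > 0"
begin

lemma L_zero [simp]: "L 0 = 0" and M_zero [simp]: "M 0 = 0"
  using L_add[of 0 0] M_add[of 0 0] by simp_all

lemma L_diff: "L (x - y) = L x - L y"
  using L_add[of "x - y" y] by simp

text \<open>
  If \<open>ML\<close> has a nonpositive eigenvalue on \<open>E p\<close> below the middle degree, then \<open>M\<close> carries the
  eigenvector to an eigenvector in \<open>E (p - 2)\<close> with a smaller eigenvalue.
\<close>

lemma eigenvector_below_middle:
  assumes "x \<in> E p" and "int p < m" and "M (L x) = scale (of_int \<mu>) x" and "\<mu> \<le> 0"
  shows "x = 0"
  using assms
proof (induction p arbitrary: x \<mu> rule: less_induct)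
  case (less p)
  define \<nu> where "\<nu> = \<mu> - c * (m - int p)"
  have "c * (m - int p) > 0" using c_pos less.prems by simp
  then have \<nu>: "\<nu> < 0" using less.prems by (simp add: \<nu>_def)
  have LM: "L (M x) = scale (of_int \<nu>) x"
    using comm[OF less.prems(1)] less.prems(3) by (simp add: \<nu>_def scale_left_diff_distrib algebra_simps)
  have "M x = 0"
  proof (cases "p < 2")
    case True
    then show ?thesis using M_low less.prems by blast
  next
    case False
    then have "p - 2 + 2 = p" by simp
    then have "M x \<in> E (p - 2)" using M_E[of x "p - 2"] less.prems by metis
    moreover have "M (L (M x)) = scale (of_int \<nu>) (M x)" by (simp add: LM M_scale)
    ultimately show ?thesis
      using less.IH[of "p - 2" "M x" \<nu>] \<nu> False less.prems by simp
  qed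
  \<comment> \<open>With \<open>M x = 0\<close>, the relation \<open>LM\<close> forces
    \<open>x = 0\<close> because \<nu> is strictly negative.\<close>
  with LM \<nu> show ?case by simp
qed

text \<open>A kernel element of \<open>L\<close> is an eigenvector of \<open>ML\<close> with
  eigenvalue 0.\<close>

lemma inj_on_below_middle:
  assumes "int p < m"
  shows "inj_on L (E p)"
proof (rule inj_onI)
  fix x y assume *: "x \<in> E p" "y \<in> E p" "L x = L y"
  then have "x - y \<in> E p" using subspace_E by (simp add: subspace_diff)
  moreover have "M (L (x - y)) = scale (of_int 0) (x - y)" using * by (simp add: L_diff)
  ultimately have "x - y = 0" using assms eigenvector_below_middle by blast
  then show "x = y" by simp
qed

section \<open>Powers of the raising operator and surjectivity above the middle degree\<close>

lemma L_pow_scale: "(L ^^ k) (scale a x) = scale a ((L ^^ k) x)"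
  by (induction k) (simp_all add: L_scale)

lemma L_pow_diff: "(L ^^ k) (x - y) = (L ^^ k) x - (L ^^ k) y"
  by (induction k) (simp_all add: L_diff)

lemma L_pow_E: "x \<in> E p \<Longrightarrow> (L ^^ k) x \<in> E (p + 2 * k)"
  by (induction k) (use L_E in fastforce)+

text \<open>Moving \<open>M\<close> past \<open>k + 1\<close> copies of \<open>L\<close> collects
  the commutator scalars in degrees \<open>p\<close>, \<open>p + 2\<close>, ...,
  \<open>p + 2k\<close>, whose sum is \<open>c (k + 1) (m - p - k)\<close>.\<close>

lemma M_L_pow:
  assumes "x \<in> E p"
  shows "M ((L ^^ Suc k) x) =
    (L ^^ Suc k) (M x) - scale (of_int (c * (int k + 1) * (int p + int k - m))) ((L ^^ k) x)"
proof (induction k)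
  case 0
  show ?case using comm[OF assms] by (simp add: algebra_simps scale_left_diff_distrib)
next
  case (Suc k)
  have "M ((L ^^ Suc (Suc k)) x) = L (M ((L ^^ Suc k) x)) +
      scale (of_int (c * (m - int (p + 2 * Suc k)))) ((L ^^ Suc k) x)"
    using comm[OF L_pow_E[OF assms, of "Suc k"]] by simp
  also have "\<dots> = (L ^^ Suc (Suc k)) (M x) -
      scale (of_int (c * (int k + 1) * (int p + int k - m)) - of_int (c * (m - int (p + 2 * Suc k)))) ((L ^^ Suc k) x)"
    by (simp only: Suc.IH L_diff L_scale scale_left_diff_distrib) simp
  also have "of_int (c * (int k + 1) * (int p + int k - m)) - of_int (c * (m - int (p + 2 * Suc k))) =
      (of_int (c * (int (Suc k) + 1) * (int p + int (Suc k) - m)) :: 'a)"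
    unfolding of_int_diff[symmetric] by (rule arg_cong[where f = of_int]) (simp add: algebra_simps)
  finally show ?case .
qed

text \<open>Induction on \<open>k\<close>: applying \<open>M\<close> to the vanishing of the next
  power shows that the \<open>k\<close>-th power of \<open>L\<close> kills
  \<open>L (M x) - a x\<close>, with \<open>a > 0\<close> above the middle. That vector is then in
  the range, hence so is \<open>x\<close>.\<close>

lemma nilpotent_in_range_above_middle:
  assumes "x \<in> E (p + 2)" and "int (p + 2) > m" and "(L ^^ k) x = 0"
  shows "x \<in> L ` E p"
  using assms
proof (induction k arbitrary: x)
  case 0
  then have "x = L 0" by simp
  moreover have "0 \<in> E p" using subspace_E by (rule subspace_0)
  ultimately show ?case by blast
next
  case (Suc k)
  define a where "a = c * (int k + 1) * (int (p + 2) + int k - m)"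
  have "a > 0" using c_pos Suc.prems by (simp add: a_def)
  then have a: "(of_int a :: 'a) \<noteq> 0" by simp
  have Mx: "M x \<in> E p" using Suc.prems by (simp add: M_E)
  have "M ((L ^^ Suc k) x) = (L ^^ Suc k) (M x) - scale (of_int a) ((L ^^ k) x)"
    using M_L_pow[OF Suc.prems(1), of k] by (simp only: a_def)
  then have "(L ^^ k) (L (M x) - scale (of_int a) x) = 0"
    unfolding Suc.prems(3) by (simp only: M_zero L_pow_diff L_pow_scale funpow_Suc_right comp_apply)
  moreover have "L (M x) - scale (of_int a) x \<in> E (p + 2)"
    using Suc.prems Mx L_E subspace_E by (simp add: subspace_diff subspace_scale)
  ultimately obtain y where y: "y \<in> E p" "L (M x) - scale (of_int a) x = L y"
    using Suc.IH Suc.prems by blast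
  have "x = scale (inverse (of_int a)) (scale (of_int a) x)" using a by simp
  also have "scale (of_int a) x = L (M x - y)" using y(2) by (simp add: L_diff algebra_simps)
  finally have "x = L (scale (inverse (of_int a)) (M x - y))" by (simp only: L_scale)
  moreover have "scale (inverse (of_int a)) (M x - y) \<in> E p"
    using Mx y subspace_E by (simp add: subspace_diff subspace_scale)
  ultimately show ?case by blast
qed

end

section \<open>The Cayley form as a symplectic form\<close>

text \<open>The binomial expansion stops after the term linear in \<open>a\<close>.\<close>

lemma power_Suc_add_square_zero:
  fixes a b :: "'a::ring_1"
  assumes "a * a = 0" and "a * b = b * a"
  shows "(a + b) ^ Suc k = b ^ Suc k + of_nat (Suc k) * (a * b ^ k)"
proof (induction k)
  case (Suc k)
  have ba: "b * (a * x) = a * (b * x)" for x by (metis assms(2) mult.assoc)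
  have aa: "a * (a * x) = 0" for x by (metis assms(1) mult.assoc mult_zero_left)
  define c :: 'a where "c = of_nat (Suc k)"
  have "c * y = y * c" for y unfolding c_def by (rule mult_of_nat_commute)
  then have ac: "a * (c * y) = c * (a * y)" and bc: "b * (c * y) = c * (b * y)" for y
    by (metis mult.assoc)+
  have "(a + b) ^ Suc (Suc k) = (a + b) * (b ^ Suc k + c * (a * b ^ k))"
    using Suc.IH by (simp only: power_Suc c_def)
  also have "\<dots> = b ^ Suc (Suc k) + (1 + c) * (a * b ^ Suc k)"
    by (simp add: distrib_left distrib_right ac bc ba aa)
  finally show ?case by (simp only: c_def of_nat_Suc[of "Suc k"])
qed simp

text \<open>Adding one summand raises the exponent by one, so both terms of the truncated expansion
  contain a power of the old sum that already vanishes.\<close>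

lemma sum_square_zero_nilpotent:
  fixes f :: "'i \<Rightarrow> 'a::ring_1"
  assumes "finite A" and "\<And>i. f i * f i = 0" and "\<And>i j. f i * f j = f j * f i"
  shows "(\<Sum>i\<in>A. f i) ^ Suc (card A) = 0"
  using assms(1)
proof (induction A rule: finite_induct)
  case (insert i A)
  have "f i * sum f A = sum f A * f i"
    by (simp add: sum_distrib_left sum_distrib_right assms(3))
  from power_Suc_add_square_zero[OF assms(2) this, of "Suc (card A)"] insert show ?case
    by simp
qed simp

section \<open>Signs, complementary indices and the basis expansion of the Cayley form\<close>

definition complement :: "('d \<Rightarrow> 2) \<Rightarrow> 'd \<Rightarrow> 2"
  where "complement i = (\<lambda>j. i j + 1)"

definition index_sign :: "('d::finite \<Rightarrow> 2) \<Rightarrow> complex"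
  where "index_sign i = (\<Prod>j\<in>UNIV. if i j = 1 then 1 else - 1)"

abbreviation basis_vec :: "'b \<Rightarrow> 'b::finite exterior"
  where "basis_vec i \<equiv> ext_vec (axis i 1)"

lemma complement_complement [simp]: "complement (complement i) = i"
  by (auto simp: complement_def fun_eq_iff add.assoc)

lemma complement_eq_iff: "complement i = j \<longleftrightarrow> i = complement j"
  by auto

lemma index_sign_square [simp]: "index_sign i * index_sign i = 1"
  unfolding index_sign_def prod.distrib[symmetric] by (rule prod.neutral) simp

text \<open>Each of the \<open>d\<close> factors changes sign. This is where the parity of
  \<open>d\<close> enters: it makes the form alternating rather than symmetric in the pair of
  complementary indices.\<close>

lemma index_sign_complement:
  assumes "odd CARD('d::finite)"
  shows "index_sign (complement (i :: 'd \<Rightarrow> 2)) = - index_sign i"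
proof -
  have "(if i j + 1 = 1 then 1 else - 1 :: complex) = - 1 * (if i j = 1 then 1 else - 1)" for j
    using exhaust_2[of "i j"] by auto
  then have "index_sign (complement i) = (- 1) ^ CARD('d) * index_sign i"
    by (simp only: index_sign_def complement_def prod.distrib prod_constant)
  with assms show ?thesis by simp
qed

lemma pure_tensor_std_basis: "pure_tensor (\<lambda>j. std_basis (i j)) = axis i 1"
proof -
  have "(\<Prod>j\<in>UNIV. std_basis (i j) $ k j) = axis i 1 $ k" for k :: "'a \<Rightarrow> 2"
  proof (cases "k = i")
    case False
    then obtain j where "k j \<noteq> i j" by auto
    then have "std_basis (i j) $ k j = 0" by (simp add: axis_def)
    then have "(\<Prod>j\<in>UNIV. std_basis (i j) $ k j) = 0" by (meson UNIV_I finite prod_zero)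
    with False show ?thesis by (simp add: axis_def)
  qed (simp add: axis_def)
  then show ?thesis by (simp add: pure_tensor_def vec_eq_iff)
qed

lemma of_int_eq_ext_const: "of_int k = ext_const (of_int k)"
proof (induction k rule: int_induct[where k = 0])
  case base
  have "ext_const 0 = (ext_const 0 + ext_const 0 :: 'a exterior)"
    by (simp flip: ext_const_add)
  then show ?case by simp
next
  case (step1 i)
  then show ?case by (simp add: ext_const_add ext_const_1)
next
  case (step2 i)
  have "ext_const (of_int i) = (ext_const (of_int (i - 1)) + 1 :: 'a exterior)"
    by (simp flip: ext_const_1 ext_const_add)
  with step2 show ?case by simp
qed

lemma permutes_2_eq:
  fixes \<pi> :: "2 \<Rightarrow> 2"
  assumes "\<pi> permutes UNIV"
  shows "Transposition.transpose 1 (\<pi> 1) = \<pi>"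
proof
  fix x
  have "\<pi> 1 \<noteq> \<pi> 2" using permutes_inj[OF assms] by (simp add: inj_eq)
  then show "Transposition.transpose 1 (\<pi> 1) x = \<pi> x"
    using exhaust_2[of "\<pi> 1"] exhaust_2[of "\<pi> 2"] exhaust_2[of x]
    by (metis transpose_apply_first transpose_apply_second transpose_apply_other)
qed

text \<open>A permutation of two points is determined by the image of 1, so families of permutations
  correspond to indices \<open>i\<close>; the images of 2 then form the complementary index.\<close>

lemma cayley_form_eq:
  "cayley_form = (\<Sum>i\<in>UNIV. ext_scale (index_sign i) (basis_vec i * basis_vec (complement i)))"
  unfolding cayley_form_def
proof (rule sum.reindex_bij_witness[where i = "\<lambda>i j. Transposition.transpose 1 (i j)" and j = "\<lambda>\<pi> j. \<pi> j 1"])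
  fix \<pi> :: "'a \<Rightarrow> 2 \<Rightarrow> 2"
  assume "\<pi> \<in> {\<pi>. \<forall>j. \<pi> j permutes UNIV}"
  then have \<pi>: "Transposition.transpose 1 (\<pi> j 1) = \<pi> j" for j by (intro permutes_2_eq) simp
  then show "(\<lambda>j. Transposition.transpose 1 (\<pi> j 1)) = \<pi>" by simp
  have "\<pi> j 2 = \<pi> j 1 + 1" for j
    using exhaust_2[of "\<pi> j 1"] by (subst \<pi>[symmetric]) (auto simp: Transposition.transpose_def)
  then have 2: "(\<lambda>j. \<pi> j 2) = complement (\<lambda>j. \<pi> j 1)" by (simp add: complement_def)
  have "sign (\<pi> j) = (if \<pi> j 1 = 1 then 1 else - 1)" for j
    by (subst \<pi>[symmetric]) (auto simp: sign_swap_id)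
  then have "complex_of_int (sign (\<pi> j)) = (if \<pi> j 1 = 1 then 1 else - 1)" for j by simp
  then have "complex_of_int (\<Prod>j\<in>UNIV. sign (\<pi> j)) = index_sign (\<lambda>j. \<pi> j 1)"
    by (simp only: index_sign_def of_int_prod)
  then show "ext_scale (index_sign (\<lambda>j. \<pi> j 1))
      (basis_vec (\<lambda>j. \<pi> j 1) * basis_vec (complement (\<lambda>j. \<pi> j 1))) =
    of_int (\<Prod>j\<in>UNIV. sign (\<pi> j)) *
       (ext_vec (pure_tensor (\<lambda>j. std_basis (\<pi> j 1))) *
        ext_vec (pure_tensor (\<lambda>j. std_basis (\<pi> j 2))))"
    by (simp only: of_int_eq_ext_const ext_scale_def 2[symmetric] pure_tensor_std_basis)
qed (auto simp: permutes_swap_id)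

text \<open>The summands are products of two vectors: such elements commute with each other, and
  each squares to zero because its vectors repeat.\<close>

lemma cayley_form_nilpotent: "\<exists>k. cayley_form ^ k = (0 :: ('d::finite \<Rightarrow> 2) exterior)"
proof -
  let ?f = "\<lambda>i :: 'd \<Rightarrow> 2. ext_scale (index_sign i) (basis_vec i * basis_vec (complement i))"
  have "ext_vec u * ext_vec v * (ext_vec u * ext_vec v) = 0" for u v :: "complex^('d \<Rightarrow> 2)"
    by (simp add: mult.assoc ext_vec_left_anticommute[of v u] ext_vec_square)
  then have "?f i * ?f i = 0" for i
    by (simp add: ext_scale_mult_left ext_scale_mult_right)
  moreover
  \<comment> \<open>Passing one vector across two costs two signs; doing this twice makes products
    of two vectors commute.\<close>
  have even: "ext_vec u * ext_vec v * ext_vec w = ext_vec w * (ext_vec u * ext_vec v)"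
    for u v w :: "complex^('d \<Rightarrow> 2)"
    by (simp add: mult.assoc ext_vec_anticommute[of v w] ext_vec_left_anticommute[of u w])
  have "ext_vec u * ext_vec v * (ext_vec w * ext_vec x) = ext_vec w * ext_vec x * (ext_vec u * ext_vec v)"
    for u v w x :: "complex^('d \<Rightarrow> 2)"
  proof -
    have "ext_vec u * ext_vec v * (ext_vec w * ext_vec x) = ext_vec w * (ext_vec u * ext_vec v * ext_vec x)"
      unfolding mult.assoc[symmetric, of _ _ "ext_vec x"] even[of u v w] ..
    also have "\<dots> = ext_vec w * ext_vec x * (ext_vec u * ext_vec v)"
      unfolding even[of u v x] by (rule mult.assoc[symmetric])
    finally show ?thesis .
  qed
  note comm = this
  have "?f i * ?f j = ?f j * ?f i" for i j
    unfolding ext_scale_mult_left ext_scale_mult_right comm[of "axis i 1" _ "axis j 1"]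
    by (rule ext.scale_left_commute)
  ultimately have "cayley_form ^ Suc CARD('d \<Rightarrow> 2) = (0 :: ('d \<Rightarrow> 2) exterior)"
    unfolding cayley_form_eq by (intro sum_square_zero_nilpotent) simp_all
  then show ?thesis ..
qed

section \<open>The dual lowering operator and its commutator\<close>

definition cayley_contr :: "('d::finite \<Rightarrow> 2) exterior \<Rightarrow> ('d \<Rightarrow> 2) exterior"
  where "cayley_contr x = (\<Sum>i\<in>UNIV. ext_scale (index_sign i) (contr (complement i) (contr i x)))"

lemma cayley_contr_add: "cayley_contr (x + y) = cayley_contr x + cayley_contr y"
  by (simp add: cayley_contr_def contr_add ext.scale_right_distrib sum.distrib)

lemma cayley_contr_scale: "cayley_contr (ext_scale c x) = ext_scale c (cayley_contr x)"
  by (simp add: cayley_contr_def contr_scale ext.scale_sum_right mult.commute)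

lemma contr_basis_mult:
  "contr j (basis_vec i * x) = (if i = j then x else 0) - basis_vec i * contr j x"
  by (simp add: contr_vec_mult axis_def)

lemma contr_cayley_mult:
  assumes "odd CARD('d::finite)"
  shows "contr j (cayley_form * x) =
    cayley_form * contr j x + ext_scale (2 * index_sign j) (basis_vec (complement j) * (x :: ('d \<Rightarrow> 2) exterior))"
proof -
  have "contr j (basis_vec i * basis_vec (complement i) * x) =
      (if i = j then basis_vec (complement i) * x else 0)
      - (if complement i = j then basis_vec i * x else 0)
      + basis_vec i * basis_vec (complement i) * contr j x" for i
    by (simp add: mult.assoc contr_basis_mult right_diff_distrib)
  then have "contr j (cayley_form * x) =
      (\<Sum>i\<in>UNIV. ext_scale (index_sign i) (if i = j then basis_vec (complement i) * x else 0))
      - (\<Sum>i\<in>UNIV. ext_scale (index_sign i) (if complement i = j then basis_vec i * x else 0))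
      + cayley_form * contr j x"
    unfolding cayley_form_eq
    by (simp only: sum_distrib_right contr_sum ext_scale_mult_left contr_scale ext.scale_right_distrib
        ext.scale_right_diff_distrib sum.distrib sum_subtractf)
  also have "(\<Sum>i\<in>UNIV. ext_scale (index_sign i) (if i = j then basis_vec (complement i) * x else 0)) =
      ext_scale (index_sign j) (basis_vec (complement j) * x)"
    by (simp add: if_distrib[of "ext_scale _"] cong: if_cong)
  also have "(\<Sum>i\<in>UNIV. ext_scale (index_sign i) (if complement i = j then basis_vec i * x else 0)) =
      ext_scale (index_sign (complement j)) (basis_vec (complement j) * x)"
    unfolding complement_eq_iff by (simp add: if_distrib[of "ext_scale _"] cong: if_cong)
  \<comment> \<open>The indices \<open>j\<close> and \<open>complement j\<close> contribute the same
    vector with opposite signs; the subtraction doubles it instead of cancelling it.\<close>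
  also have "ext_scale (index_sign j) (basis_vec (complement j) * x)
        - ext_scale (index_sign (complement j)) (basis_vec (complement j) * x) + cayley_form * contr j x =
      cayley_form * contr j x + ext_scale (2 * index_sign j) (basis_vec (complement j) * x)"
    unfolding index_sign_complement[OF assms] mult_2 ext.scale_left_distrib ext.scale_minus_left
    by simp
  finally show ?thesis .
qed

lemma cayley_contr_mult:
  fixes x :: "('d::finite \<Rightarrow> 2) exterior"
  assumes odd: "odd CARD('d)" and "x \<in> ext_power p"
  shows "cayley_contr (cayley_form * x) =
    cayley_form * cayley_contr x + ext_scale (of_int (4 * (2 ^ (CARD('d) - 1) - int p))) x"
proof -
  note sgn = index_sign_complement[OF odd]
  have two: "index_sign i * (2 * index_sign i) = 2" for i :: "'d \<Rightarrow> 2"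
    by (simp only: mult.left_commute[of "index_sign i" 2] index_sign_square mult_1_right)
  \<comment> \<open>Apply \<open>contr_cayley_mult\<close> for \<open>i\<close> and then for
    \<open>complement i\<close>; the product of the two opposite signs is -1.\<close>
  have summand: "ext_scale (index_sign i) (contr (complement i) (contr i (cayley_form * x))) =
      cayley_form * ext_scale (index_sign i) (contr (complement i) (contr i x)) + ext_scale 2 x
      - ext_scale 2 (basis_vec i * contr i x)
      - ext_scale 2 (basis_vec (complement i) * contr (complement i) x)" for i
    by (simp add: contr_cayley_mult[OF odd] contr_add contr_scale contr_basis_mult sgn
        ext.scale_right_distrib ext.scale_right_diff_distrib ext_scale_mult_right
        two)
  \<comment> \<open>Complementation permutes the indices, so both correction terms sum to the number
    operator.\<close>
  have N: "(\<Sum>i\<in>UNIV. basis_vec (complement i) * contr (complement i) x) =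
      (\<Sum>i\<in>UNIV. basis_vec i * contr i x)"
    by (rule sum.reindex_bij_witness[where i = complement and j = complement]) auto
  have card: "CARD('d \<Rightarrow> 2) = 2 * 2 ^ (CARD('d) - 1)"
    using odd by (simp add: card_fun odd_pos flip: power_Suc)
  have "cayley_contr (cayley_form * x) = cayley_form * cayley_contr x
      + ext_scale (of_nat CARD('d \<Rightarrow> 2) * 2) x - ext_scale 2 (ext_scale (of_nat p) x)
      - ext_scale 2 (ext_scale (of_nat p) x)"
    unfolding cayley_contr_def summand
    by (simp add: sum.distrib sum_subtractf sum_distrib_left N sum_vec_contr[OF assms(2)]
        ext.sum_constant_scale del: sum_constant flip: ext.scale_sum_right)
  also have "\<dots> = cayley_form * cayley_contr x + ext_scale (of_nat CARD('d \<Rightarrow> 2) * 2 - 2 * of_nat p - 2 * of_nat p) x"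
    by (simp only: ext.scale_scale ext.scale_left_diff_distrib add_diff_eq)
  also have "of_nat CARD('d \<Rightarrow> 2) * 2 - 2 * of_nat p - 2 * of_nat p =
      (of_int (4 * (2 ^ (CARD('d) - 1) - int p)) :: complex)"
    unfolding card by simp
  finally show ?thesis .
qed

lemma graded_lefschetz_cayley:
  assumes "odd CARD('d::finite)"
  shows "graded_lefschetz ext_scale (ext_power :: nat \<Rightarrow> ('d \<Rightarrow> 2) exterior set)
    (\<lambda>v. cayley_form * v) cayley_contr 4 (2 ^ (CARD('d) - 1))"
proof unfold_locales
  fix x :: "('d \<Rightarrow> 2) exterior" and p
  show "cayley_form * x \<in> ext_power (p + 2)" if "x \<in> ext_power p"
    using ext_power_mult[OF cayley_form_in_ext_power_2 that] by (simp add: add.commute)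
  show "cayley_contr x \<in> ext_power p" if "x \<in> ext_power (p + 2)"
    unfolding cayley_contr_def using that
    by (intro ext_power_sum ext_power_scale contr_power_Suc) simp
  show "cayley_contr x = 0" if "x \<in> ext_power p" "p < 2"
  proof -
    \<comment> \<open>In degree 0 the inner contraction vanishes; in degree 1 it lands in degree 0,
      where the outer one vanishes.\<close>
    have "contr j (contr i x) = 0" for i j
      using that contr_power_0 contr_power_Suc[of x 0] by (cases p) (auto simp: less_2_cases_iff)
    then show ?thesis by (simp add: cayley_contr_def)
  qed
qed (simp_all add: distrib_left ext_scale_mult_right cayley_contr_add cayley_contr_scale
    subspace_ext_power cayley_contr_mult[OF assms])

theorem corollary5p6:
  fixes d n :: nat and L :: "('d::finite \<Rightarrow> 2) exterior \<Rightarrow> ('d \<Rightarrow> 2) exterior"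
  assumes "CARD('d) = d" and "d \<ge> 3" and "odd d"
    and "n \<le> 2 ^ d - 2"
    and "L = (\<lambda>v. cayley_form * v)"
  shows "inj_on L (ext_power n) \<or> L ` ext_power n = ext_power (n + 2)"
proof -
  interpret graded_lefschetz ext_scale "ext_power :: nat \<Rightarrow> ('d \<Rightarrow> 2) exterior set"
    L cayley_contr 4 "2 ^ (CARD('d) - 1)"
    using graded_lefschetz_cayley assms by blast
  show ?thesis
  proof (cases "int n < 2 ^ (CARD('d) - 1)")
    case True
    then show ?thesis using inj_on_below_middle by blast
  next
    case False
    \<comment> \<open>From the middle degree on, \<open>n + 2\<close> lies strictly above it, and
      nilpotency of the form makes the criterion apply to every element of degree
      \<open>n + 2\<close>.\<close>
    obtain k where k: "cayley_form ^ k = (0 :: ('d \<Rightarrow> 2) exterior)"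
      using cayley_form_nilpotent by blast
    have "(L ^^ l) x = cayley_form ^ l * x" for l x
      by (induction l) (simp_all add: assms(5) mult.assoc)
    then have "(L ^^ k) x = 0" for x using k by simp
    moreover have "int (n + 2) > 2 ^ (CARD('d) - 1)" using False by linarith
    ultimately have "ext_power (n + 2) \<subseteq> L ` ext_power n"
      using nilpotent_in_range_above_middle by blast
    with L_E show ?thesis by blast
  qed
qed

end
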